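(* Let $\mathcal{H}$ be a non-trivial complex Hilbert space, let $A\neq 0$ be a positive operator on $\mathcal{H}$, and let $T\in \mathcal{B}_{A^{1/2}}(\mathcal{H})$. Then $$\omega_A(T^n)\leq \omega_A(T)^n\quad\text{for all } n\in\mathbb{N}^*.$$
   Context: $\mathcal{B}(\mathcal{H})$ is the algebra of bounded linear operators on $\mathcal{H}$; inner product $\langle\cdot\mid\cdot\rangle$. $A\in\mathcal{B}(\mathcal{H})$ is positive if $\langle Ax\mid x\rangle\ge 0$ for all $x\in\mathcal{H}$. Put $\langle x\mid y\rangle_A:=\langle Ax\mid y\rangle$ and $\|x\|_A:=\langle x\mid x\rangle_A^{1/2}$ (a seminorm). $\mathcal{B}_{A^{1/2}}(\mathcal{H})$ is the set of $A$-bounded operators: those $T\in\mathcal{B}(\mathcal{H})$ for which there is $\lambda>0$ with $\|Tx\|_A\le\lambda\|x\|_A$ for all $x\in\mathcal{H}$. The $A$-numerical radius is $\omega_A(T):=\sup\{|\langle Tx\mid x\rangle_A| : x\in\mathcal{H},\ \|x\|_A=1\}$. $\mathbb{N}^*$ is the set of positive integers. *)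

theory Defs
  imports "HOL-Analysis.Analysis"
begin

text \<open>
  A complex Hilbert space: a Banach space with a scalar multiplication by complex numbers that
  extends the real one, whose norm comes from a complex inner product. The inner product is
  linear in the first argument and conjugate-linear in the second. Completeness is
  inherited from \<^class>\<open>banach\<close>.
\<close>

class complex_hilbert_space = banach +
  fixes scaleC :: "complex \<Rightarrow> 'a \<Rightarrow> 'a" (infixr "*\<^sub>C" 75)
    and cinner :: "'a \<Rightarrow> 'a \<Rightarrow> complex"
  assumes scaleC_add_right: "a *\<^sub>C (x + y) = a *\<^sub>C x + a *\<^sub>C y"
    and scaleC_add_left: "(a + b) *\<^sub>C x = a *\<^sub>C x + b *\<^sub>C x"
    and scaleC_scaleC: "a *\<^sub>C (b *\<^sub>C x) = (a * b) *\<^sub>C x"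
    and scaleC_one: "1 *\<^sub>C x = x"
    and scaleC_of_real: "complex_of_real r *\<^sub>C x = r *\<^sub>R x"
    and cinner_commute: "cinner x y = cnj (cinner y x)"
    and cinner_add_left: "cinner (x + y) z = cinner x z + cinner y z"
    and cinner_scaleC_left: "cinner (a *\<^sub>C x) y = a * cinner x y"
    and cinner_ge_zero: "cinner x x \<in> \<real>\<^sub>\<ge>\<^sub>0"
    and cinner_eq_zero_iff: "cinner x x = 0 \<longleftrightarrow> x = 0"
    and norm_eq_sqrt_cinner: "norm x = sqrt (Re (cinner x x))"

instantiation complex :: complex_hilbert_space
begin

definition scaleC_complex :: "complex \<Rightarrow> complex \<Rightarrow> complex" where
  "scaleC_complex a x = a * x"

definition cinner_complex :: "complex \<Rightarrow> complex \<Rightarrow> complex" where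
  "cinner_complex x y = x * cnj y"

instance
proof
  fix x :: complex
  have eq: "cinner x x = complex_of_real ((cmod x)\<^sup>2)"
    by (simp only: cinner_complex_def complex_norm_square)
  show "cinner x x \<in> \<real>\<^sub>\<ge>\<^sub>0"
    unfolding eq by (simp only: nonneg_Reals_of_real_iff) simp
  show "norm x = sqrt (Re (cinner x x))"
    unfolding eq by (simp only: Re_complex_of_real) simp
qed (auto simp: scaleC_complex_def cinner_complex_def algebra_simps scaleR_conv_of_real)

end

definition bounded_clinear ::
  "('a::complex_hilbert_space \<Rightarrow> 'a) \<Rightarrow> bool" where
  "bounded_clinear T \<longleftrightarrow> bounded_linear T \<and> (\<forall>c x. T (c *\<^sub>C x) = c *\<^sub>C T x)"

definition positive_operator :: "('a::complex_hilbert_space \<Rightarrow> 'a) \<Rightarrow> bool" where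
  "positive_operator A \<longleftrightarrow> bounded_clinear A \<and> (\<forall>x. cinner (A x) x \<in> \<real>\<^sub>\<ge>\<^sub>0)"

definition A_inner ::
  "('a::complex_hilbert_space \<Rightarrow> 'a) \<Rightarrow> 'a \<Rightarrow> 'a \<Rightarrow> complex" where
  "A_inner A x y = cinner (A x) y"

text \<open>For positive \<^term>\<open>A\<close> the complex number \<^term>\<open>A_inner A x x\<close> is real and
  nonnegative, so taking its real part loses nothing.\<close>

definition A_norm :: "('a::complex_hilbert_space \<Rightarrow> 'a) \<Rightarrow> 'a \<Rightarrow> real" where
  "A_norm A x = sqrt (Re (A_inner A x x))"

definition A_bounded_operators ::
  "('a::complex_hilbert_space \<Rightarrow> 'a) \<Rightarrow> ('a \<Rightarrow> 'a) set" where
  "A_bounded_operators A =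
     {T. bounded_clinear T \<and> (\<exists>c>0. \<forall>x. A_norm A (T x) \<le> c * A_norm A x)}"

text \<open>The supremum is taken in the reals. For positive \<^term>\<open>A\<close> other than the zero operator and
  \<^term>\<open>A\<close>-bounded \<^term>\<open>T\<close> the set is nonempty and, by the Cauchy--Schwarz inequality for
  \<^term>\<open>A_inner A\<close>, bounded above, so this is the actual least upper bound.\<close>

definition A_numerical_radius ::
  "('a::complex_hilbert_space \<Rightarrow> 'a) \<Rightarrow> ('a \<Rightarrow> 'a) \<Rightarrow> real" where
  "A_numerical_radius A T = (SUP x\<in>{x. A_norm A x = 1}. cmod (A_inner A (T x) x))"

end

theory Submission
  imports Defs
begin

text \<open>
  Pearcy's argument, carried out for the semi-inner product of \<^term>\<open>A\<close>. Let
  \<open>w\<^sub>0, \<dots>, w\<^sub>n\<^sub>-\<^sub>1\<close> be the \<open>n\<close>-th roots of unity, let \<open>\<omega>\<^sub>A(T) |a| \<le> 1\<close> and put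
  \<open>x\<^sub>j = \<Sum>k<n. (w\<^sub>j a)\<^sup>k T\<^sup>k x\<close>. Then \<open>x\<^sub>j - w\<^sub>j a T x\<^sub>j = x - a\<^sup>n T\<^sup>n x\<close> does not depend on \<open>j\<close>, the
  real part of \<open>\<langle>x\<^sub>j - w\<^sub>j a T x\<^sub>j | x\<^sub>j\<rangle>\<^sub>A\<close> is nonnegative, and \<open>\<Sum>j. x\<^sub>j = n x\<close>. Summing over \<open>j\<close>
  gives \<open>Re (a\<^sup>n \<langle>T\<^sup>n x | x\<rangle>\<^sub>A) \<le> \<parallel>x\<parallel>\<^sub>A\<^sup>2\<close>, and it remains to choose the modulus and the argument
  of \<open>a\<close>.
\<close>

section \<open>Power sums of roots of unity\<close>

lemma sum_powers_roots_of_unity: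
  assumes "k < n"
  shows "(\<Sum>j<n. cis (2 * pi * real j / real n) ^ k) = (if k = 0 then of_nat n else 0)"
proof (cases "k = 0")
  case False
  \<comment> \<open>With \<open>k\<close> fixed, the summands are successive powers of
    \<open>z\<close>, an \<open>n\<close>-th root of unity other than 1 because
    \<open>0 < k < n\<close>; so the geometric sum vanishes.\<close>
  define z where "z = cis (2 * pi * real k / real n)"
  have powers: "cis (2 * pi * real j / real n) ^ k = z ^ j" for j
    unfolding z_def Complex.DeMoivre by (simp add: mult_ac)
  have "z \<noteq> 1"
  proof
    assume "z = 1"
    then obtain m :: int where "2 * pi * real k / real n = of_int m * (2 * pi)"
      by (auto simp: z_def complex_eq_iff cos_one_2pi_int)
    with assms have "real k = of_int m * real n"
      by (simp add: field_simps)
    then have "int k = m * int n"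
      by (metis of_int_eq_iff of_int_mult of_int_of_nat_eq)
    then have "n dvd k"
      by (metis dvd_triv_right int_dvd_int_iff)
    with assms False show False
      by (auto dest: dvd_imp_le)
  qed
  moreover have "z ^ n = 1"
    using assms unfolding z_def Complex.DeMoivre by (simp add: complex_eq_iff)
  ultimately show ?thesis
    using False by (simp add: powers geometric_sum)
qed simp

section \<open>Algebra in a complex Hilbert space\<close>

lemma scaleC_zero_right [simp]: "a *\<^sub>C (0::'a::complex_hilbert_space) = 0"
  by (metis add_cancel_right_right scaleC_add_right)

lemma scaleC_zero_left [simp]: "0 *\<^sub>C (x::'a::complex_hilbert_space) = 0"
  by (metis of_real_0 scaleC_of_real scaleR_zero_left)

lemma scaleC_sum_left:
  "(\<Sum>i\<in>I. f i) *\<^sub>C (x::'a::complex_hilbert_space) = (\<Sum>i\<in>I. f i *\<^sub>C x)"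
  by (induction I rule: infinite_finite_induct) (simp_all add: scaleC_add_left)

lemma cinner_add_right:
  "cinner x (y + z) = cinner x y + cinner x (z::'a::complex_hilbert_space)"
  by (metis cinner_commute cinner_add_left complex_cnj_add)

lemma cinner_scaleC_right:
  "cinner x (a *\<^sub>C y) = cnj a * cinner x (y::'a::complex_hilbert_space)"
  by (metis cinner_commute cinner_scaleC_left complex_cnj_mult)

lemma bounded_clinear_add: "bounded_clinear T \<Longrightarrow> T (x + y) = T x + T y"
  by (simp add: bounded_clinear_def linear_simps)

lemma bounded_clinear_scaleC: "bounded_clinear T \<Longrightarrow> T (a *\<^sub>C x) = a *\<^sub>C T x"
  by (simp add: bounded_clinear_def)

section \<open>The semi-inner product of a positive operator\<close>

context
  fixes A :: "'a::complex_hilbert_space \<Rightarrow> 'a"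
  assumes A_pos: "positive_operator A"
begin

lemma A_inner_add_left: "A_inner A (x + y) z = A_inner A x z + A_inner A y z"
  and A_inner_scaleC_left: "A_inner A (a *\<^sub>C x) y = a * A_inner A x y"
  and A_inner_add_right: "A_inner A x (y + z) = A_inner A x y + A_inner A x z"
  and A_inner_scaleC_right: "A_inner A x (a *\<^sub>C y) = cnj a * A_inner A x y"
  using A_pos
  by (simp_all add: positive_operator_def A_inner_def bounded_clinear_add bounded_clinear_scaleC
      cinner_add_left cinner_scaleC_left cinner_add_right cinner_scaleC_right)

lemmas A_inner_expand =
  A_inner_add_left A_inner_scaleC_left A_inner_add_right A_inner_scaleC_right

lemma A_inner_diff_left: "A_inner A (x - y) z = A_inner A x z - A_inner A y z"
  by (metis A_inner_add_left add_diff_cancel_right' diff_add_cancel)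

lemma A_inner_sum_right: "A_inner A x (\<Sum>i\<in>I. f i) = (\<Sum>i\<in>I. A_inner A x (f i))"
proof -
  have "A_inner A x 0 = 0"
    using A_inner_scaleC_right[of x 0 0] by simp
  then show ?thesis
    by (induction I rule: infinite_finite_induct) (simp_all add: A_inner_add_right)
qed

lemma A_norm_power2: "(A_norm A x)\<^sup>2 = Re (A_inner A x x)"
  and A_inner_self: "A_inner A x x = of_real ((A_norm A x)\<^sup>2)"
  and A_norm_nonneg: "A_norm A x \<ge> 0"
proof -
  have "A_inner A x x \<in> \<real>\<^sub>\<ge>\<^sub>0"
    using A_pos by (simp add: positive_operator_def A_inner_def)
  then have "0 \<le> Re (A_inner A x x)" "Im (A_inner A x x) = 0"
    by (auto simp: complex_nonneg_Reals_iff)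
  then show "(A_norm A x)\<^sup>2 = Re (A_inner A x x)" "A_inner A x x = of_real ((A_norm A x)\<^sup>2)"
    "A_norm A x \<ge> 0"
    by (simp_all add: A_norm_def complex_eq_iff)
qed

lemma A_norm_scaleR: "A_norm A (r *\<^sub>R x) = \<bar>r\<bar> * A_norm A x"
proof -
  have "(A_norm A (r *\<^sub>R x))\<^sup>2 = (\<bar>r\<bar> * A_norm A x)\<^sup>2"
    unfolding A_norm_power2 power_mult_distrib
    by (simp add: scaleC_of_real[symmetric] A_inner_expand power2_eq_square)
  then show ?thesis
    by (simp add: A_norm_nonneg)
qed

text \<open>Polarization: the form is real on the diagonal. Reality at \<open>x + y\<close> makes
  the imaginary parts of the two mixed products opposite, and reality at
  \<open>x + \<i> *\<^sub>C y\<close> makes their real parts equal.\<close>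

lemma A_inner_commute: "A_inner A x y = cnj (A_inner A y x)"
proof -
  have "Im (A_inner A (x + y) (x + y)) = 0" "Im (A_inner A (x + \<i> *\<^sub>C y) (x + \<i> *\<^sub>C y)) = 0"
    "Im (A_inner A x x) = 0" "Im (A_inner A y y) = 0"
    using A_inner_self by (metis Im_complex_of_real)+
  then show ?thesis
    by (simp add: A_inner_expand complex_eq_iff)
qed

lemma A_Cauchy_Schwarz: "cmod (A_inner A x y) \<le> A_norm A x * A_norm A y"
proof -
  define v where "v = cmod (A_inner A x y)"
  \<comment> \<open>The phase of the product: rotating \<open>y\<close> by \<open>b\<close> turns
    the mixed term into the real number \<open>v\<close>, so that \<open>quadratic\<close> expresses
    nonnegativity of a real polynomial in \<open>t\<close>.\<close>
  define b where "b = sgn (A_inner A x y)"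
  have quadratic: "2 * t * v \<le> (A_norm A x)\<^sup>2 + t\<^sup>2 * (A_norm A y)\<^sup>2" for t :: real
  proof (cases "v = 0")
    case False
    have b: "b * cnj b = 1" "cnj b * A_inner A x y = of_real v"
      using False by (simp_all add: b_def v_def sgn_eq complex_norm_square[symmetric]
          power2_eq_square field_simps flip: of_real_mult)
    have "A_inner A (x + (- of_real t * b) *\<^sub>C y) (x + (- of_real t * b) *\<^sub>C y) =
        A_inner A x x - of_real t * (cnj b * A_inner A x y)
        - of_real t * cnj (cnj b * A_inner A x y) + of_real (t\<^sup>2) * (b * cnj b) * A_inner A y y"
      by (simp add: A_inner_expand A_inner_commute[of y x] algebra_simps power2_eq_square)
    then have "A_inner A (x + (- of_real t * b) *\<^sub>C y) (x + (- of_real t * b) *\<^sub>C y) =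
        of_real ((A_norm A x)\<^sup>2 - 2 * t * v + t\<^sup>2 * (A_norm A y)\<^sup>2)"
      unfolding b by (simp add: A_inner_self)
    then have "(A_norm A (x + (- of_real t * b) *\<^sub>C y))\<^sup>2 =
        (A_norm A x)\<^sup>2 - 2 * t * v + t\<^sup>2 * (A_norm A y)\<^sup>2"
      by (simp add: A_norm_power2)
    moreover have "(A_norm A (x + (- of_real t * b) *\<^sub>C y))\<^sup>2 \<ge> 0"
      by simp
    ultimately show ?thesis
      by linarith
  qed simp
  have "v \<le> A_norm A x * A_norm A y"
  proof (cases "A_norm A y = 0")
    case True
    \<comment> \<open>The form is only semidefinite. Here the quadratic term drops out, and for
      nonzero \<open>v\<close> the chosen \<open>t\<close> would make the left side exceed the right
      by 1.\<close>
    then have "v = 0"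
      using quadratic[of "((A_norm A x)\<^sup>2 + 1) / (2 * v)"] by (cases "v = 0") auto
    with True show ?thesis
      by simp
  next
    case False
    \<comment> \<open>The value of \<open>t\<close> used here minimizes the quadratic
      polynomial.\<close>
    then have "v\<^sup>2 / (A_norm A y)\<^sup>2 \<le> (A_norm A x)\<^sup>2"
      using quadratic[of "v / (A_norm A y)\<^sup>2"] by (simp add: power2_eq_square)
    with False have "v\<^sup>2 \<le> (A_norm A x * A_norm A y)\<^sup>2"
      by (simp add: power_mult_distrib divide_le_eq)
    then show ?thesis
      by (rule power2_le_imp_le) (simp add: A_norm_nonneg)
  qed
  then show ?thesis
    by (simp add: v_def)
qed

text \<open>If \<open>A x\<close> is nonzero, then so is \<open>A_inner A x (A x)\<close>, the
  squared norm of \<open>A x\<close>. Cauchy-Schwarz then forbids \<open>A_norm A x = 0\<close>, and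
  \<open>x\<close> can be normalized.\<close>

lemma exists_A_norm_eq_1:
  assumes "A \<noteq> (\<lambda>x. 0)"
  shows "\<exists>x. A_norm A x = 1"
proof -
  obtain x where x: "A x \<noteq> 0"
    using assms by auto
  then have "A_inner A x (A x) \<noteq> 0"
    by (simp add: A_inner_def cinner_eq_zero_iff)
  then have "A_norm A x \<noteq> 0"
    using A_Cauchy_Schwarz[of x "A x"] by auto
  then have "A_norm A ((1 / A_norm A x) *\<^sub>R x) = 1"
    using A_norm_nonneg[of x] by (simp add: A_norm_scaleR)
  then show ?thesis ..
qed

section \<open>Pearcy's argument for an \<open>A\<close>-bounded operator\<close>

context
  fixes T :: "'a \<Rightarrow> 'a"
  assumes T_bounded: "T \<in> A_bounded_operators A"
begin

lemma T_clinear: "bounded_clinear T"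
  using T_bounded by (simp add: A_bounded_operators_def)

lemma A_inner_le_A_numerical_radius:
  "cmod (A_inner A (T y) y) \<le> A_numerical_radius A T * (A_norm A y)\<^sup>2"
proof -
  obtain c where c: "\<And>x. A_norm A (T x) \<le> c * A_norm A x"
    using T_bounded by (auto simp: A_bounded_operators_def)
  \<comment> \<open>This serves twice: it settles vectors of seminorm zero, which cannot be
    normalized, and it bounds the set whose real supremum is taken.\<close>
  have bound: "cmod (A_inner A (T x) x) \<le> c * A_norm A x * A_norm A x" for x
    using A_Cauchy_Schwarz[of "T x" x] mult_right_mono[OF c A_norm_nonneg, of x x] by linarith
  show ?thesis
  proof (cases "A_norm A y = 0")
    case True
    then show ?thesis
      using bound[of y] by simp
  next
    case False
    define r where "r = A_norm A y"
    have r: "r > 0"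
      using False A_norm_nonneg[of y] by (simp add: r_def)
    define u where "u = of_real (1 / r) *\<^sub>C y"
    have u: "A_norm A u = 1"
      using r by (simp add: u_def r_def scaleC_of_real A_norm_scaleR del: of_real_divide)
    have "A_inner A (T u) u = of_real (1 / r\<^sup>2) * A_inner A (T y) y"
      by (simp add: u_def A_inner_expand bounded_clinear_scaleC[OF T_clinear] power2_eq_square)
    then have "cmod (A_inner A (T u) u) = cmod (A_inner A (T y) y) / r\<^sup>2"
      by (simp add: norm_mult norm_divide norm_power)
    moreover have "cmod (A_inner A (T u) u) \<le> A_numerical_radius A T"
      unfolding A_numerical_radius_def
    proof (rule cSUP_upper)
      show "bdd_above ((\<lambda>x. cmod (A_inner A (T x) x)) ` {x. A_norm A x = 1})"
      proof (rule bdd_aboveI2[of _ _ c])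
        show "cmod (A_inner A (T x) x) \<le> c" if "x \<in> {x. A_norm A x = 1}" for x
          using bound[of x] that by simp
      qed
    qed (use u in simp)
    ultimately show ?thesis
      using r by (simp add: r_def field_simps)
  qed
qed

text \<open>Applying \<open>b\<close> times \<open>T\<close> shifts the sum by one index, so only
  the two end terms survive.\<close>

lemma telescope_powers:
  "(\<Sum>k<n. b ^ k *\<^sub>C (T ^^ k) x) - b *\<^sub>C T (\<Sum>k<n. b ^ k *\<^sub>C (T ^^ k) x) =
    x - b ^ n *\<^sub>C (T ^^ n) x"
proof (induction n)
  case 0
  then show ?case
    using bounded_clinear_scaleC[OF T_clinear, of 0 0] by (simp add: scaleC_one)
next
  case (Suc n)
  have "b *\<^sub>C T (b ^ n *\<^sub>C (T ^^ n) x) = b ^ Suc n *\<^sub>C (T ^^ Suc n) x"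
    by (simp add: bounded_clinear_scaleC[OF T_clinear] scaleC_scaleC)
  then have "(\<Sum>k<Suc n. b ^ k *\<^sub>C (T ^^ k) x) - b *\<^sub>C T (\<Sum>k<Suc n. b ^ k *\<^sub>C (T ^^ k) x) =
    ((\<Sum>k<n. b ^ k *\<^sub>C (T ^^ k) x) - b *\<^sub>C T (\<Sum>k<n. b ^ k *\<^sub>C (T ^^ k) x)) +
    b ^ n *\<^sub>C (T ^^ n) x - b ^ Suc n *\<^sub>C (T ^^ Suc n) x"
    by (simp only: sum.lessThan_Suc bounded_clinear_add[OF T_clinear] scaleC_add_right) simp
  then show ?case
    by (simp only: Suc.IH) simp
qed

lemma Re_A_inner_power_le:
  assumes n: "n \<ge> 1" and a: "cmod a * A_numerical_radius A T \<le> 1"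
  shows "Re (a ^ n * A_inner A ((T ^^ n) x) x) \<le> (A_norm A x)\<^sup>2"
proof -
  define w where "w j = cis (2 * pi * real j / real n)" for j
  define y where "y j = (\<Sum>k<n. (w j * a) ^ k *\<^sub>C (T ^^ k) x)" for j
  define z where "z = x - a ^ n *\<^sub>C (T ^^ n) x"
  have w: "w j ^ n = 1" for j
    using n unfolding w_def Complex.DeMoivre by (simp add: complex_eq_iff)
  have z: "y j - (w j * a) *\<^sub>C T (y j) = z" for j
    using telescope_powers[of "w j * a" x n] by (simp add: y_def z_def power_mult_distrib w)
  have nonneg: "Re (A_inner A z (y j)) \<ge> 0" for j
  proof -
    have "Re (w j * a * A_inner A (T (y j)) (y j)) \<le> cmod (w j * a * A_inner A (T (y j)) (y j))"
      by (rule complex_Re_le_cmod)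
    also have "\<dots> = cmod a * cmod (A_inner A (T (y j)) (y j))"
      by (simp add: norm_mult w_def)
    also have "\<dots> \<le> cmod a * (A_numerical_radius A T * (A_norm A (y j))\<^sup>2)"
      by (intro mult_left_mono A_inner_le_A_numerical_radius) simp
    also have "\<dots> \<le> (A_norm A (y j))\<^sup>2"
      using mult_right_mono[OF a, of "(A_norm A (y j))\<^sup>2"] by (simp add: mult_ac)
    finally show ?thesis
      by (simp add: z[of j, symmetric] A_inner_diff_left A_inner_scaleC_left A_norm_power2)
  qed
  \<comment> \<open>After exchanging the sums, the coefficient of \<open>(T ^^ k) x\<close> contains
    a power sum of the roots of unity, which removes every term but \<open>k = 0\<close>.\<close>
  have "(\<Sum>j<n. y j) = (\<Sum>k<n. ((\<Sum>j<n. w j ^ k) * a ^ k) *\<^sub>C (T ^^ k) x)"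
    unfolding y_def
    by (subst sum.swap) (simp add: scaleC_sum_left[symmetric] sum_distrib_right power_mult_distrib)
  also have "\<dots> = (\<Sum>k<n. if k = 0 then of_nat n *\<^sub>C x else 0)"
    by (rule sum.cong) (auto simp: w_def sum_powers_roots_of_unity)
  also have "\<dots> = of_nat n *\<^sub>C x"
    using n by simp
  finally have "of_nat n * A_inner A z x = (\<Sum>j<n. A_inner A z (y j))"
    by (metis A_inner_scaleC_right A_inner_sum_right complex_cnj_of_nat)
  then have "real n * Re (A_inner A z x) = (\<Sum>j<n. Re (A_inner A z (y j)))"
    by (metis Re_sum Re_complex_of_real of_real_of_nat_eq times_complex.sel(1)
        Im_complex_of_real mult_zero_left diff_zero)
  also have "\<dots> \<ge> 0"
    by (intro sum_nonneg nonneg)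
  finally have "Re (A_inner A z x) \<ge> 0"
    using n by (simp add: zero_le_mult_iff)
  then show ?thesis
    by (simp add: z_def A_inner_diff_left A_inner_scaleC_left A_norm_power2)
qed

lemma A_inner_power_le:
  assumes n: "n \<ge> 1" and r: "r \<ge> 0" "r * A_numerical_radius A T \<le> 1"
  shows "r ^ n * cmod (A_inner A ((T ^^ n) x) x) \<le> (A_norm A x)\<^sup>2"
proof -
  define v where "v = A_inner A ((T ^^ n) x) x"
  \<comment> \<open>The argument is chosen so that \<open>a ^ n\<close> cancels the phase of
    \<open>v\<close>; the bound on the real part thus becomes one on the modulus.\<close>
  define a where "a = of_real r * cis (- Arg v / real n)"
  have "a ^ n = of_real (r ^ n) * cis (- Arg v)"
    using n unfolding a_def power_mult_distrib Complex.DeMoivre by simp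
  then have "a ^ n * v = of_real (r ^ n) * cis (- Arg v) * (of_real (cmod v) * cis (Arg v))"
    by (metis rcis_cmod_Arg rcis_def)
  also have "\<dots> = of_real (r ^ n * cmod v)"
    by (simp add: mult_ac cis_mult flip: cis_inverse)
  finally show ?thesis
    using Re_A_inner_power_le[OF n, of a x] r by (simp add: a_def v_def norm_mult)
qed

end

end

theorem theorem2p5:
  fixes A T :: "'a::complex_hilbert_space \<Rightarrow> 'a"
  assumes nontrivial: "\<exists>x::'a. x \<noteq> 0"
    and A_pos: "positive_operator A"
    and A_nonzero: "A \<noteq> (\<lambda>x. 0)"
    and T_bounded: "T \<in> A_bounded_operators A"
  shows "\<forall>n::nat. n \<ge> 1 \<longrightarrow> A_numerical_radius A (T ^^ n) \<le> A_numerical_radius A T ^ n"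
proof (intro allI impI)
  fix n :: nat
  assume n: "n \<ge> 1"
  define \<omega> where "\<omega> = A_numerical_radius A T"
  \<comment> \<open>The unit vector \<open>e\<close> shows both that \<omega> is nonnegative and
    that the final supremum is over a nonempty set.\<close>
  obtain e where e: "A_norm A e = 1"
    using exists_A_norm_eq_1[OF A_pos A_nonzero] by auto
  have "0 \<le> cmod (A_inner A (T e) e)"
    by simp
  also have "\<dots> \<le> \<omega>"
    using A_inner_le_A_numerical_radius[OF A_pos T_bounded, of e] e by (simp add: \<omega>_def)
  finally have \<omega>: "\<omega> \<ge> 0" .
  have "cmod (A_inner A ((T ^^ n) x) x) \<le> \<omega> ^ n" if x: "A_norm A x = 1" for x
  proof -
    define v where "v = cmod (A_inner A ((T ^^ n) x) x)"
    \<comment> \<open>The factor \<open>r\<close> stays free because \<omega> may be zero, which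
      excludes \<open>1 / \<omega>\<close>.\<close>
    have key: "r ^ n * v \<le> 1" if "r \<ge> 0" "r * \<omega> \<le> 1" for r
      using A_inner_power_le[OF A_pos T_bounded n, of r x] that x by (simp add: v_def \<omega>_def)
    have "v \<le> \<omega> ^ n"
    proof (cases "\<omega> = 0")
      case True
      have "v = 0"
      proof (rule ccontr)
        assume "v \<noteq> 0"
        then have v: "v > 0"
          by (simp add: v_def)
        \<comment> \<open>With \<omega> zero every nonnegative \<open>r\<close> is admissible in
          \<open>key\<close>. This one gives \<open>r * v = v + 1\<close>, and
          \<open>r \<ge> 1\<close> ensures that \<open>r ^ n\<close> is no smaller than
          \<open>r\<close>.\<close>
        define r where "r = 1 + 1 / v"
        have "1 < r * v"
          using v by (simp add: r_def field_simps)
        also have "r * v \<le> r ^ n * v"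
          using v n by (intro mult_right_mono self_le_power) (simp_all add: r_def)
        finally show False
          using key[of r] v True by (simp add: r_def)
      qed
      with True n show ?thesis
        by simp
    next
      case False
      with \<omega> show ?thesis
        using key[of "1 / \<omega>"] by (simp add: field_simps)
    qed
    then show ?thesis
      by (simp add: v_def)
  qed
  then show "A_numerical_radius A (T ^^ n) \<le> A_numerical_radius A T ^ n"
    unfolding A_numerical_radius_def[of A "T ^^ n"] \<omega>_def[symmetric]
    using e by (intro cSUP_least) auto
qed

end
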